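(* Let $p\ge4$, $k\ge p$, $b=2\lceil\frac{k-2}{p-2}\rceil$, $D=p(b-1)$, and let $\bar c=(c_1,\dots,c_b)$ be a 2-flat sequence of integers from $[0,2^{k-1}-1]$. Let $f=f_D\circ f_{D-1}\circ\dots\circ f_1$ where $f_i=Q_{((i-1)\bmod p)+1}$ for $i=1,\dots,D$. Then $f(\bar c)$ is flat.
   Context: Flat: $c_1\le\dots\le c_{2m}\le c_1+1$. 2-flat: $(c_1,c_3,\dots,c_{2m-1})$ and $(c_2,c_4,\dots,c_{2m})$ both flat. Let $h_s=2^{k-s-1}-1$ for $1\le s\le k-1$. Maps $\mathbb R^b\to\mathbb R^b$ (unmentioned coordinates unchanged): $cyc$: coordinate 1 becomes $\max(c_1,c_b-1)$, coordinate $b$ becomes $\min(c_1+1,c_b)$; $dec_{j,s}$ ($1\le j\le b/2$, $1\le s\le k-1$): coordinate $j$ becomes $\min(c_j,c_{b-j+1}+h_s)$, coordinate $b-j+1$ becomes $\max(c_j-h_s,c_{b-j+1})$; $mov_j$ ($1\le j\le b/2$): for $t\in\{j,b-j\}$ coordinate $t$ becomes $\min(c_t,c_{t+1})$, for $t\in\{j+1,b-j+1\}$ coordinate $t$ becomes $\max(c_{t-1},c_t)$. For $x=1,\dots,p$: $MV_x=\{mov_j:1\le j\le\frac{k-2}{p-2},\ x+j\equiv1\pmod p\}$, $DC_x=\{dec_{j,s}:1\le j\le b/2,\ (x+j)\bmod p\notin\{1,2\},\ s=(p-2)(j-1)-1+((x+j-1)\bmod p)\le k-1\}$; $Q_1=\{cyc\}\cup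 MV_1\cup DC_1$, $Q_x=MV_x\cup DC_x$ ($2\le x\le p$). The functions in one $Q_x$ modify pairwise disjoint coordinates, and $Q_x$ denotes the map obtained by composing all of them (in any order). *)

theory Defs
  imports Complex_Main "HOL-Number_Theory.Cong"
begin

text \<open>
  A sequence \<open>(c\<^sub>1, \<dots>, c\<^sub>n)\<close> is a function \<open>c :: nat \<Rightarrow> real\<close> of which only the values at
  \<open>1, \<dots>, n\<close> matter; accordingly a self-map of \<open>\<real>\<^sup>b\<close> is a function on such sequences that
  leaves all positions outside \<open>{1..b}\<close> alone.
\<close>

definition flat :: "nat \<Rightarrow> (nat \<Rightarrow> real) \<Rightarrow> bool" where
  "flat n c \<longleftrightarrow> (\<forall>i. 1 \<le> i \<and> i < n \<longrightarrow> c i \<le> c (i + 1)) \<and> c n \<le> c 1 + 1"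

definition two_flat :: "nat \<Rightarrow> (nat \<Rightarrow> real) \<Rightarrow> bool" where
  "two_flat n c \<longleftrightarrow>
     flat (n div 2) (\<lambda>i. c (2 * i - 1)) \<and> flat (n div 2) (\<lambda>i. c (2 * i))"

definition blk :: "nat \<Rightarrow> nat \<Rightarrow> nat" where
  "blk p k = 2 * nat \<lceil>(real k - 2) / (real p - 2)\<rceil>"

definition hgt :: "nat \<Rightarrow> nat \<Rightarrow> real" where
  "hgt k s = 2 ^ (k - s - 1) - 1"

definition cyc :: "nat \<Rightarrow> (nat \<Rightarrow> real) \<Rightarrow> nat \<Rightarrow> real" where
  "cyc b c = (\<lambda>t. if t = 1 then max (c 1) (c b - 1)
                  else if t = b then min (c 1 + 1) (c b)
                  else c t)"

definition dec :: "nat \<Rightarrow> nat \<Rightarrow> nat \<Rightarrow> nat \<Rightarrow> (nat \<Rightarrow> real) \<Rightarrow> nat \<Rightarrow> real" where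
  "dec b k j s c = (\<lambda>t. if t = j then min (c j) (c (b - j + 1) + hgt k s)
                        else if t = b - j + 1 then max (c j - hgt k s) (c (b - j + 1))
                        else c t)"

definition mov :: "nat \<Rightarrow> nat \<Rightarrow> (nat \<Rightarrow> real) \<Rightarrow> nat \<Rightarrow> real" where
  "mov b j c = (\<lambda>t. if t \<in> {j, b - j} then min (c t) (c (t + 1))
                    else if t \<in> {j + 1, b - j + 1} then max (c (t - 1)) (c t)
                    else c t)"

definition MV :: "nat \<Rightarrow> nat \<Rightarrow> nat \<Rightarrow> ((nat \<Rightarrow> real) \<Rightarrow> nat \<Rightarrow> real) set" where
  "MV p k x = {mov (blk p k) j | j.
     1 \<le> j \<and> real j \<le> (real k - 2) / (real p - 2) \<and> [x + j = 1] (mod p)}"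

text \<open>The index \<open>s\<close> is computed over the integers, since \<open>(p - 2) (j - 1) - 1\<close> is
  negative for \<open>j = 1\<close>.\<close>

definition DC :: "nat \<Rightarrow> nat \<Rightarrow> nat \<Rightarrow> ((nat \<Rightarrow> real) \<Rightarrow> nat \<Rightarrow> real) set" where
  "DC p k x = {dec (blk p k) k j s | j s.
     1 \<le> j \<and> j \<le> blk p k div 2 \<and> (x + j) mod p \<notin> {1, 2} \<and>
     int s = (int p - 2) * (int j - 1) - 1 + int ((x + j - 1) mod p) \<and> s \<le> k - 1}"

definition Q :: "nat \<Rightarrow> nat \<Rightarrow> nat \<Rightarrow> ((nat \<Rightarrow> real) \<Rightarrow> nat \<Rightarrow> real) set" where
  "Q p k x = (if x = 1 then {cyc (blk p k)} else {}) \<union> MV p k x \<union> DC p k x"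

definition compose_all :: "('a \<Rightarrow> 'a) set \<Rightarrow> 'a \<Rightarrow> 'a" where
  "compose_all F = Finite_Set.fold (\<circ>) id F"

definition Qmap :: "nat \<Rightarrow> nat \<Rightarrow> nat \<Rightarrow> (nat \<Rightarrow> real) \<Rightarrow> nat \<Rightarrow> real" where
  "Qmap p k x = compose_all (Q p k x)"


subsection \<open>The composition does not depend on the order\<close>

definition acts_on :: "((nat \<Rightarrow> real) \<Rightarrow> nat \<Rightarrow> real) \<Rightarrow> nat set \<Rightarrow> bool" where
  "acts_on g A \<longleftrightarrow> (\<forall>c i. i \<notin> A \<longrightarrow> g c i = c i) \<and>
     (\<forall>c d. (\<forall>a\<in>A. c a = d a) \<longrightarrow> (\<forall>i\<in>A. g c i = g d i))"

lemma acts_on_commute: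
  assumes "acts_on g A" "acts_on h B" "A \<inter> B = {}"
  shows "g \<circ> h = h \<circ> g"
proof (intro ext)
  fix c i
  have g: "\<And>c i. i \<notin> A \<Longrightarrow> g c i = c i"
    and g': "\<And>c d i. (\<forall>a\<in>A. c a = d a) \<Longrightarrow> i \<in> A \<Longrightarrow> g c i = g d i"
    using assms(1) unfolding acts_on_def by blast+
  have h: "\<And>c i. i \<notin> B \<Longrightarrow> h c i = c i"
    and h': "\<And>c d i. (\<forall>a\<in>B. c a = d a) \<Longrightarrow> i \<in> B \<Longrightarrow> h c i = h d i"
    using assms(2) unfolding acts_on_def by blast+
  have a: "\<forall>a\<in>A. h c a = c a" and b: "\<forall>a\<in>B. g c a = c a"
    using g h assms(3) by blast+
  consider "i \<in> A" "i \<notin> B" | "i \<in> B" "i \<notin> A" | "i \<notin> A" "i \<notin> B" using assms(3) by blast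
  then show "(g \<circ> h) c i = (h \<circ> g) c i"
    by cases (use g' [OF a] h' [OF b] g h in auto)
qed

lemma acts_on_cyc: "acts_on (cyc b) {1, b}"
  by (auto simp: acts_on_def cyc_def)

lemma acts_on_dec: "acts_on (dec b k j s) {j, b - j + 1}"
  by (auto simp: acts_on_def dec_def)

lemma acts_on_mov: "acts_on (mov b j) {j, j + 1, b - j, b - j + 1}"
  by (auto simp: acts_on_def mov_def)

lemma blk_half:
  fixes j :: nat
  assumes "4 \<le> p" "p \<le> k" "real j \<le> (real k - 2) / (real p - 2)"
  shows "2 * j \<le> blk p k"
proof -
  have "int j \<le> \<lceil>(real k - 2) / (real p - 2)\<rceil>"
    using assms(3) by (metis ceiling_mono ceiling_of_nat)
  then show ?thesis unfolding blk_def by linarith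
qed

lemma blk_ge_2: "4 \<le> p \<Longrightarrow> p \<le> k \<Longrightarrow> 2 \<le> blk p k"
  using blk_half[of p k 1] by simp

lemma cong_gap:
  fixes p x i j :: nat
  assumes "[x + i = 1] (mod p)" "[x + j = 1] (mod p)" "i < j"
  shows "i + p \<le> j"
proof -
  have "[x + i = x + j] (mod p)" using assms cong_trans cong_sym by blast
  then have "[i = j] (mod p)" by (simp add: cong_add_lcancel_nat)
  then have "p dvd j - i" using assms(3) by (metis cong_def mod_eq_dvd_iff_nat less_imp_le)
  then have "p \<le> j - i" using assms(3) by (intro dvd_imp_le) auto
  then show ?thesis using assms(3) by linarith
qed

lemma Q_disjoint:
  assumes p: "4 \<le> p" "p \<le> k" and "g \<in> Q p k x" "h \<in> Q p k x" "g \<noteq> h"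
  shows "\<exists>A B. acts_on g A \<and> acts_on h B \<and> A \<inter> B = {} \<and> A \<union> B \<subseteq> {1..blk p k}"
proof -
  define b where "b = blk p k"
  obtain m where m: "b = 2 * m" unfolding b_def blk_def by blast
  have b2: "2 \<le> b" using blk_ge_2[OF p] b_def by simp
  define P where "P = (\<lambda>g h. \<exists>A B. acts_on g A \<and> acts_on h B \<and> A \<inter> B = {} \<and> A \<union> B \<subseteq> {1..b})"
  have PI: "P g h" if "acts_on g A" "acts_on h B" "A \<inter> B = {}" "A \<union> B \<subseteq> {1..b}" for g h A B
    unfolding P_def using that by blast
  have sym: "P g h \<Longrightarrow> P h g" for g h unfolding P_def by (metis Int_commute Un_commute)
  have mvE: "\<exists>j. g = mov b j \<and> 1 \<le> j \<and> 2 * j \<le> b \<and> [x + j = 1] (mod p)"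
    if "g \<in> MV p k x" for g
    using that blk_half[OF p] unfolding MV_def b_def by blast
  have dcE: "\<exists>j s. g = dec b k j s \<and> 1 \<le> j \<and> 2 * j \<le> b \<and> (x + j) mod p \<noteq> 1 \<and>
      (x + j) mod p \<noteq> 2 \<and> int s = (int p - 2) * (int j - 1) - 1 + int ((x + j - 1) mod p)"
    if "g \<in> DC p k x" for g
    using that unfolding DC_def b_def[symmetric] m by force
  have mod1: "(x + j) mod p = 1" "(x + (j + 1)) mod p = 2" if "[x + j = 1] (mod p)" for j
  proof -
    show 1: "(x + j) mod p = 1" using that p unfolding cong_def by simp
    have "(x + (j + 1)) mod p = ((x + j) mod p + 1) mod p" by (metis add.assoc mod_add_left_eq)
    then show "(x + (j + 1)) mod p = 2" using 1 p by simp
  qed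
  have mm: "P (mov b i) (mov b j)"
    if "1 \<le> i" "2 * j \<le> b" "[x + i = 1] (mod p)" "[x + j = 1] (mod p)" "i < j" for i j
  proof -
    have "i + 4 \<le> j" using cong_gap[OF that(3,4,5)] p by linarith
    then have "{i, i + 1, b - i, b - i + 1} \<inter> {j, j + 1, b - j, b - j + 1} = {}"
      "{i, i + 1, b - i, b - i + 1} \<union> {j, j + 1, b - j, b - j + 1} \<subseteq> {1..b}"
      using that(1,2) unfolding m by auto
    then show ?thesis by (rule PI[OF acts_on_mov acts_on_mov])
  qed
  have md: "P (mov b i) (dec b k j s)"
    if "1 \<le> i" "2 * i \<le> b" "1 \<le> j" "2 * j \<le> b" "[x + i = 1] (mod p)"
       "(x + j) mod p \<noteq> 1" "(x + j) mod p \<noteq> 2" for i j s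
  proof -
    have "j \<noteq> i" "j \<noteq> i + 1" using mod1[OF that(5)] that(6,7) by auto
    then have "{i, i + 1, b - i, b - i + 1} \<inter> {j, b - j + 1} = {}"
      "{i, i + 1, b - i, b - i + 1} \<union> {j, b - j + 1} \<subseteq> {1..b}"
      using that(1-4) unfolding m by auto
    then show ?thesis by (rule PI[OF acts_on_mov acts_on_dec])
  qed
  have dd: "P (dec b k i s) (dec b k j t)"
    if "1 \<le> i" "2 * i \<le> b" "1 \<le> j" "2 * j \<le> b" "i \<noteq> j" for i j s t
  proof -
    have "{i, b - i + 1} \<inter> {j, b - j + 1} = {}" "{i, b - i + 1} \<union> {j, b - j + 1} \<subseteq> {1..b}"
      using that unfolding m by auto
    then show ?thesis by (rule PI[OF acts_on_dec acts_on_dec])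
  qed
  have cm: "P (cyc b) (mov b j)" if "1 \<le> j" "2 * j \<le> b" "[1 + j = 1] (mod p)" for j
  proof -
    have "p dvd j" using that(3) by (metis add_0_right cong_0_iff cong_add_lcancel_nat)
    then have "4 \<le> j" using that(1) p dvd_imp_le[of p j] by linarith
    then have "{1, b} \<inter> {j, j + 1, b - j, b - j + 1} = {}"
      "{1, b} \<union> {j, j + 1, b - j, b - j + 1} \<subseteq> {1..b}"
      using that(2) b2 unfolding m by auto
    then show ?thesis by (rule PI[OF acts_on_cyc acts_on_mov])
  qed
  have cd: "P (cyc b) (dec b k j s)" if "1 \<le> j" "2 * j \<le> b" "(1 + j) mod p \<noteq> 2" for j s
  proof -
    have "j \<noteq> 1" using that(3) p by auto
    then have "{1, b} \<inter> {j, b - j + 1} = {}" "{1, b} \<union> {j, b - j + 1} \<subseteq> {1..b}"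
      using that(1,2) b2 unfolding m by auto
    then show ?thesis by (rule PI[OF acts_on_cyc acts_on_dec])
  qed
  have MM: "P g h" if gh: "g \<in> MV p k x" "h \<in> MV p k x" "g \<noteq> h" for g h
  proof -
    obtain i j where *: "g = mov b i" "1 \<le> i" "2 * i \<le> b" "[x + i = 1] (mod p)"
      "h = mov b j" "1 \<le> j" "2 * j \<le> b" "[x + j = 1] (mod p)"
      using mvE[OF gh(1)] mvE[OF gh(2)] by blast
    have "i < j \<or> j < i" using *(1,5) gh(3) by (metis nat_neq_iff)
    then show ?thesis using mm[of i j] mm[of j i] sym * by blast
  qed
  have MD: "P g h" if gh: "g \<in> MV p k x" "h \<in> DC p k x" for g h
    using mvE[OF gh(1)] dcE[OF gh(2)] md by blast
  have DD: "P g h" if gh: "g \<in> DC p k x" "h \<in> DC p k x" "g \<noteq> h" for g h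
  proof -
    obtain i s j t where *: "g = dec b k i s" "1 \<le> i" "2 * i \<le> b"
      "int s = (int p - 2) * (int i - 1) - 1 + int ((x + i - 1) mod p)"
      "h = dec b k j t" "1 \<le> j" "2 * j \<le> b"
      "int t = (int p - 2) * (int j - 1) - 1 + int ((x + j - 1) mod p)"
      using dcE[OF gh(1)] dcE[OF gh(2)] by blast
    have "i \<noteq> j" using *(1,4,5,8) gh(3) by (metis of_nat_eq_iff)
    then show ?thesis using dd * by blast
  qed
  have CM: "P (cyc b) g" if "x = 1" "g \<in> MV p k x" for g
    using mvE[OF that(2)] cm that(1) by blast
  have CD: "P (cyc b) g" if "x = 1" "g \<in> DC p k x" for g
    using dcE[OF that(2)] cd that(1) by blast
  have "P g h"
  proof -
    have Qc: "(x = 1 \<and> g = cyc b) \<or> g \<in> MV p k x \<or> g \<in> DC p k x" if "g \<in> Q p k x" for g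
      using that unfolding Q_def b_def[symmetric] by (auto split: if_splits)
    show ?thesis
      using Qc[OF assms(3)] Qc[OF assms(4)] assms(5) MM MD DD CM CD sym by metis
  qed
  then show ?thesis unfolding P_def b_def .
qed

lemma compose_all_any_order:
  assumes "distinct fs" and "\<And>g h. g \<in> set fs \<Longrightarrow> h \<in> set fs \<Longrightarrow> g \<circ> h = h \<circ> g"
  shows "compose_all (set fs) = foldr (\<circ>) fs id"
proof -
  interpret comp_fun_commute_on "set fs" "(\<circ>)"
  proof
    fix g h assume "g \<in> set fs" "h \<in> set fs"
    then have "h \<circ> g = g \<circ> h" by (rule assms(2)[rotated])
    then show "(\<circ>) h \<circ> (\<circ>) g = (\<circ>) g \<circ> (\<circ>) h" by (auto simp: fun_eq_iff)
  qed
  have "Finite_Set.fold (\<circ>) id (set gs) = foldr (\<circ>) gs id"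
    if "set gs \<subseteq> set fs" "distinct gs" for gs
    using that by (induction gs) (auto simp: fold_insert)
  then show ?thesis using assms(1) unfolding compose_all_def by blast
qed

theorem Qmap_any_order:
  assumes "4 \<le> p" "p \<le> k" "distinct fs" "set fs = Q p k x"
  shows "Qmap p k x = foldr (\<circ>) fs id"
  unfolding Qmap_def assms(4)[symmetric]
proof (rule compose_all_any_order[OF assms(3)])
  fix g h assume "g \<in> set fs" "h \<in> set fs"
  then show "g \<circ> h = h \<circ> g"
    using Q_disjoint[OF assms(1,2), of g x h] acts_on_commute assms(4) by metis
qed

lemma finite_Q: "finite (Q p k x)"
proof -
  let ?b = "blk p k"
  have "MV p k x \<subseteq> mov ?b ` {j. real j \<le> (real k - 2) / (real p - 2)}"
    unfolding MV_def by blast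
  moreover have "{j. real j \<le> (real k - 2) / (real p - 2)}
      \<subseteq> {..nat \<lfloor>(real k - 2) / (real p - 2)\<rfloor>}"
    by (auto simp: le_nat_floor)
  ultimately have "finite (MV p k x)" by (meson finite_atMost finite_imageI finite_subset)
  moreover have "DC p k x \<subseteq> (\<lambda>(j, s). dec ?b k j s) ` ({..?b} \<times> {..k})"
    unfolding DC_def by force
  then have "finite (DC p k x)" by (rule finite_subset) simp
  ultimately show ?thesis unfolding Q_def by simp
qed

end

theory Submission
  imports Defs
begin

text \<open>
  Write \<open>b = 2 m\<close> and let column \<open>j \<le> m\<close> hold the pair of the coordinates \<open>j\<close> and \<open>b - j + 1\<close>. If all pair
  sums were equal, only the gaps \<open>g\<^sub>j = c\<^sub>j - c\<^bsub>b-j+1\<^esub>\<close> would matter: \<open>cyc\<close> reflects \<open>g\<^sub>1\<close> at \<open>-1\<close>,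
  \<open>dec\<^bsub>j,s\<^esub>\<close> reflects \<open>g\<^sub>j\<close> at \<open>h\<^sub>s\<close>, and \<open>mov\<^sub>j\<close> sorts \<open>g\<^sub>j, g\<^bsub>j+1\<^esub>\<close>. The pair sums of a 2-flat sequence take
  at most two consecutive integer values \<open>z\<close> and \<open>z + 1\<close>, and all maps are non-expansive in the
  supremum norm, so the pairs stay within \<open>1/4\<close> of the pairs with sum \<open>z + 1/2\<close> and these gaps.

  Gaps below \<open>-1\<close> run quickly to column \<open>1\<close>, where they are reflected, and since \<open>h\<^bsub>s-1\<^esub> = 2 h\<^sub>s + 1\<close> the
  halving along the columns never creates new ones, so column \<open>j\<close> is free of them from round
  \<open>j - 1\<close> on. Afterwards each round makes the gap of column \<open>m\<close> nonpositive and shifts the positive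
  gaps one column to the right, so column \<open>j\<close> is settled in \<open>[-1, 0]\<close> from round \<open>m + j - 1\<close> on.

  By closeness and integrality, in settled columns one half of the sequence is constant and the other
  half takes two values; the same shift keeps the settled columns of that half sorted.
\<close>

section \<open>Evolution of columns\<close>

definition level :: "nat \<Rightarrow> nat \<Rightarrow> nat \<Rightarrow> nat" where
  "level p j q = (p - 2) * (j - 1) + q - 1"

lemma level_Suc: "1 \<le> q \<Longrightarrow> level p j (Suc q) = Suc (level p j q)"
  by (simp add: level_def)

lemma level_p:
  assumes "2 \<le> p" "1 \<le> j"
  shows "level p j p = (p - 2) * j + 1"
proof -
  have "(p - 2) * (j - 1) + (p - 2) = (p - 2) * j"
    using assms(2) by (cases j) auto
  then show ?thesis
    using assms(1) unfolding level_def by linarith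
qed

lemma level_round_end:
  assumes "2 \<le> p" "1 \<le> j"
  shows "level p j (p - 1) = level p (Suc j) 1"
  using level_p[OF assms] assms(1) unfolding level_def by simp

text \<open>The operation \<open>cap s\<close> stands for \<open>dec\<^bsub>j,s\<^esub>\<close>, which is absent if \<open>s \<ge> k\<close>. The middle exchange
  \<open>mov\<^sub>m\<close> exists only if \<open>(p - 2) m = k - 2\<close>; then \<open>level p m p = k - 1\<close>, and \<open>mov\<^sub>m\<close> acts as
  \<open>dec\<^bsub>m,k-1\<^esub>\<close>, of height \<open>0\<close>.\<close>

definition column_step ::
  "nat \<Rightarrow> nat \<Rightarrow> ('a \<Rightarrow> 'a \<Rightarrow> 'a) \<Rightarrow> ('a \<Rightarrow> 'a \<Rightarrow> 'a) \<Rightarrow> ('a \<Rightarrow> 'a) \<Rightarrow> (nat \<Rightarrow> 'a \<Rightarrow> 'a) \<Rightarrow>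
    nat \<Rightarrow> (nat \<Rightarrow> 'a) \<Rightarrow> nat \<Rightarrow> 'a" where
  "column_step p m meet join wrap cap n w j =
    (if (n + j) mod p = 0 then if j < m then meet (w j) (w (Suc j)) else cap (level p j p) (w j)
     else if (n + j) mod p = 1 then if j = 1 then wrap (w j) else join (w (j - 1)) (w j)
     else cap (level p j ((n + j) mod p)) (w j))"

lemma column_step_rel:
  assumes "\<And>i. \<lbrakk>1 \<le> i; i \<le> m\<rbrakk> \<Longrightarrow> R (w i) (w' i)"
    and "\<And>x x' y y'. \<lbrakk>R x x'; R y y'\<rbrakk> \<Longrightarrow> R (meet x y) (meet' x' y')"
    and "\<And>x x' y y'. \<lbrakk>R x x'; R y y'\<rbrakk> \<Longrightarrow> R (join x y) (join' x' y')"
    and "\<And>x x'. R x x' \<Longrightarrow> R (wrap x) (wrap' x')"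
    and "\<And>s x x'. R x x' \<Longrightarrow> R (cap s x) (cap' s x')"
    and "1 \<le> j" "j \<le> m"
  shows "R (column_step p m meet join wrap cap n w j) (column_step p m meet' join' wrap' cap' n w' j)"
  using assms by (simp add: column_step_def)

locale column_evolution =
  fixes p m :: nat and meet join :: "'a \<Rightarrow> 'a \<Rightarrow> 'a" and wrap :: "'a \<Rightarrow> 'a"
    and cap :: "nat \<Rightarrow> 'a \<Rightarrow> 'a" and W :: "nat \<Rightarrow> nat \<Rightarrow> 'a"
  assumes p_ge: "4 \<le> p"
    and step: "\<lbrakk>1 \<le> j; j \<le> m\<rbrakk> \<Longrightarrow> W (Suc n) j = column_step p m meet join wrap cap n (W n) j"

lemma column_evolution_rel:
  assumes "column_evolution p m meet join wrap cap W" "column_evolution p m meet' join' wrap' cap' W'"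
    and rel_0: "\<And>j. \<lbrakk>1 \<le> j; j \<le> m\<rbrakk> \<Longrightarrow> R (W 0 j) (W' 0 j)"
    and rel_ops: "\<And>x x' y y'. \<lbrakk>R x x'; R y y'\<rbrakk> \<Longrightarrow> R (meet x y) (meet' x' y')"
      "\<And>x x' y y'. \<lbrakk>R x x'; R y y'\<rbrakk> \<Longrightarrow> R (join x y) (join' x' y')"
      "\<And>x x'. R x x' \<Longrightarrow> R (wrap x) (wrap' x')"
      "\<And>s x x'. R x x' \<Longrightarrow> R (cap s x) (cap' s x')"
    and j_range: "1 \<le> j" "j \<le> m"
  shows "R (W n j) (W' n j)"
  using j_range
proof (induction n arbitrary: j)
  case 0
  then show ?case by (rule rel_0)
next
  case (Suc n)
  show ?case
    unfolding column_evolution.step[OF assms(1) Suc.prems] column_evolution.step[OF assms(2) Suc.prems]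
    by (rule column_step_rel[where R = R]) (fact Suc.IH rel_ops Suc.prems)+
qed

lemma (in column_evolution) invariant:
  assumes "\<And>j. \<lbrakk>1 \<le> j; j \<le> m\<rbrakk> \<Longrightarrow> I (W 0 j)"
    and "\<And>x y. \<lbrakk>I x; I y\<rbrakk> \<Longrightarrow> I (meet x y)" "\<And>x y. \<lbrakk>I x; I y\<rbrakk> \<Longrightarrow> I (join x y)"
    and "\<And>x. I x \<Longrightarrow> I (wrap x)" "\<And>s x. I x \<Longrightarrow> I (cap s x)"
    and "1 \<le> j" "j \<le> m"
  shows "I (W n j)"
  by (rule column_evolution_rel[where R = "\<lambda>x _. I x", OF column_evolution_axioms
        column_evolution_axioms])
    (fact assms)+

lemma column_evolution_image:
  assumes "column_evolution p m meet join wrap cap W"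
    and "\<And>x y. h (meet x y) = meet' (h x) (h y)" "\<And>x y. h (join x y) = join' (h x) (h y)"
    and "\<And>x. h (wrap x) = wrap' (h x)" "\<And>s x. h (cap s x) = cap' s (h x)"
  shows "column_evolution p m meet' join' wrap' cap' (\<lambda>n j. h (W n j))"
proof
  show "4 \<le> p" using assms(1) by (rule column_evolution.p_ge)
next
  fix j n assume j_range: "1 \<le> j" "j \<le> m"
  show "h (W (Suc n) j) = column_step p m meet' join' wrap' cap' n (\<lambda>j. h (W n j)) j"
    unfolding column_evolution.step[OF assms(1) j_range]
    by (rule column_step_rel[where R = "\<lambda>x y. h x = y"]) (use assms j_range in auto)
qed

context column_evolution
begin

text \<open>Column \<open>j\<close> lags behind column \<open>j + 1\<close> by one step, so \<open>n + j\<close> is its local time. Round \<open>a\<close> of a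
  column begins at local time \<open>p * a + 2\<close>. Local times below \<open>j\<close>, where
  \<open>t - j\<close> is truncated, carry no meaning.\<close>

definition delayed :: "nat \<Rightarrow> nat \<Rightarrow> 'a" where
  "delayed t j = W (t - j) j"

definition last_cap :: "nat \<Rightarrow> nat" where
  "last_cap j = (if j = m then p else p - 1)"

lemma last_cap_le: "last_cap j \<le> p"
  by (simp add: last_cap_def)

lemma le_last_cap_if_less: "q < p \<Longrightarrow> q \<le> last_cap j"
  by (auto simp: last_cap_def)

lemma le_local_time: "\<lbrakk>j \<le> Suc a; 2 \<le> q\<rbrakk> \<Longrightarrow> j \<le> p * a + q"
  using p_ge mult_le_mono1[of 1 p a] by linarith

lemma delayed_Suc:
  assumes "1 \<le> j" "j \<le> m" "j \<le> t"
  shows "delayed (Suc t) j = column_step p m meet join wrap cap (t - j) (W (t - j)) j"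
  using step[OF assms(1,2), of "t - j"] assms(3) by (simp add: delayed_def Suc_diff_le)

lemma delayed_meet:
  assumes "1 \<le> j" "j < m" "j \<le> p * a + p"
  shows "delayed (p * a + Suc p) j = meet (delayed (p * a + p) j) (delayed (p * a + Suc p) (Suc j))"
  using delayed_Suc[of j "p * a + p"] assms by (simp add: column_step_def delayed_def)

lemma Suc_mult_mod_p: "Suc (p * a) mod p = 1"
  using p_ge mod_mult_self2[of 1 p a] by simp

lemma delayed_join:
  assumes "1 \<le> j" "j < m" "j \<le> p * a + p"
  shows "delayed (p * Suc a + 2) (Suc j) =
    join (delayed (p * a + p) j) (delayed (p * a + Suc p) (Suc j))"
  using delayed_Suc[of "Suc j" "p * a + Suc p"] assms Suc_mult_mod_p[of "Suc a"]
  by (simp add: column_step_def delayed_def ac_simps)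

lemma delayed_wrap:
  assumes "1 \<le> m"
  shows "delayed (p * a + 2) 1 = wrap (delayed (p * a + 1) 1)"
  using delayed_Suc[of 1 "p * a + 1"] assms Suc_mult_mod_p[of a]
  by (simp add: column_step_def delayed_def)

lemma delayed_wrap_Suc: "1 \<le> m \<Longrightarrow> delayed (p * Suc a + 2) 1 = wrap (delayed (p * a + Suc p) 1)"
  using delayed_wrap[of "Suc a"] by (simp add: ac_simps)

lemma delayed_cap:
  assumes "1 \<le> j" "j \<le> m" "2 \<le> q" "q \<le> last_cap j" "j \<le> p * a + q"
  shows "delayed (p * a + Suc q) j = cap (level p j q) (delayed (p * a + q) j)"
  using delayed_Suc[of j "p * a + q"] assms p_ge
  by (cases "q = p") (auto simp: column_step_def delayed_def last_cap_def split: if_splits)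

end

section \<open>Gaps\<close>

lemma hgt_nonneg: "0 \<le> hgt k s"
  by (simp add: hgt_def)

lemma hgt_Suc:
  assumes "Suc s < k"
  shows "hgt k s = 2 * hgt k (Suc s) + 1"
proof -
  have "k - s - 1 = Suc (k - Suc s - 1)" using assms by simp
  then show ?thesis by (simp add: hgt_def)
qed

lemma hgt_eq_0: "k \<le> Suc s \<Longrightarrow> hgt k s = 0"
  by (simp add: hgt_def)

lemma hgt_antimono: "s \<le> t \<Longrightarrow> hgt k t \<le> hgt k s"
  by (simp add: hgt_def power_increasing)

definition gap_wrap :: "real \<Rightarrow> real" where
  "gap_wrap g = max g (- 2 - g)"

definition gap_cap :: "nat \<Rightarrow> nat \<Rightarrow> real \<Rightarrow> real" where
  "gap_cap k s g = (if s < k then min g (2 * hgt k s - g) else g)"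

lemma gap_wrap_ge: "- 1 \<le> gap_wrap g"
  by (simp add: gap_wrap_def max_def)

lemma gap_cap_le: "gap_cap k s g \<le> g"
  by (simp add: gap_cap_def)

lemma gap_cap_Suc_le_hgt:
  assumes "Suc s < k \<or> g \<le> hgt k s"
  shows "gap_cap k (Suc s) g \<le> hgt k (Suc s)"
proof (cases "Suc s < k")
  case True
  then show ?thesis by (auto simp: gap_cap_def min_def)
next
  case False
  then show ?thesis using assms by (simp add: gap_cap_def hgt_eq_0)
qed

text \<open>As \<open>h\<^bsub>s-1\<^esub> = 2 h\<^sub>s + 1\<close>, reflecting at \<open>h\<^sub>s\<close> a gap bounded by \<open>h\<^bsub>s-1\<^esub>\<close> gives no value below \<open>-1\<close>.\<close>

lemma gap_cap_Suc_ge: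
  assumes "- 1 \<le> g" "g \<le> hgt k s"
  shows "- 1 \<le> gap_cap k (Suc s) g"
  using assms by (cases "Suc s < k") (auto simp: gap_cap_def hgt_Suc min_def)

locale gap_evolution = column_evolution p m min max gap_wrap "gap_cap k" G
  for p m k :: nat and G :: "nat \<Rightarrow> nat \<Rightarrow> real" +
  assumes k_gt: "(p - 2) * (m - 1) + 2 < k"
    and k_le: "k \<le> (p - 2) * m + 2"
    and abs_gap_0: "\<lbrakk>1 \<le> j; j \<le> m\<rbrakk> \<Longrightarrow> \<bar>G 0 j\<bar> \<le> hgt k 0"
begin

lemma m_ge: "1 \<le> m"
  using k_gt k_le by (cases m) auto

lemma level_2_less:
  assumes "j \<le> m"
  shows "level p j 2 < k"
proof -
  have "(p - 2) * (j - 1) \<le> (p - 2) * (m - 1)" using assms by (intro mult_le_mono2) simp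
  then show ?thesis using k_gt unfolding level_def by linarith
qed

lemma hgt_level_m_p: "hgt k (level p m p) = 0"
  using k_le m_ge p_ge by (simp add: hgt_eq_0 level_p)

lemma abs_gap_le_hgt:
  assumes "1 \<le> j" "j \<le> m"
  shows "\<bar>G n j\<bar> \<le> hgt k 0"
proof (rule invariant[where I = "\<lambda>g. \<bar>g\<bar> \<le> hgt k 0", OF abs_gap_0])
  fix s g assume "\<bar>g\<bar> \<le> hgt k 0"
  then show "\<bar>gap_cap k s g\<bar> \<le> hgt k 0"
    using hgt_nonneg[of k s] by (auto simp: gap_cap_def min_def)
qed (use assms in \<open>auto simp: gap_wrap_def min_def max_def\<close>)

lemma round_le_start:
  assumes j_range: "1 \<le> j" "j \<le> m" "j \<le> p * a + 2" and q_range: "2 \<le> q" "q \<le> Suc (last_cap j)"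
  shows "delayed (p * a + q) j \<le> delayed (p * a + 2) j"
  using q_range
proof (induction q rule: dec_induct)
  case (step q)
  have "delayed (p * a + Suc q) j \<le> delayed (p * a + q) j"
    using step j_range by (simp only: delayed_cap gap_cap_le Suc_le_mono)
  then show ?case using step by simp
qed simp

lemma round_le_hgt:
  assumes j_range: "1 \<le> j" "j \<le> m" "j \<le> p * a + 2" and q_range: "2 \<le> q" "q \<le> last_cap j"
  shows "delayed (p * a + Suc q) j \<le> hgt k (level p j q)"
  using q_range
proof (induction q rule: dec_induct)
  case base
  have "gap_cap k (level p j 2) (delayed (p * a + 2) j) \<le> hgt k (level p j 2)"
    using level_2_less[OF j_range(2)] level_Suc[of 1 p j] gap_cap_Suc_le_hgt
    by (simp add: numeral_2_eq_2)
  then show ?case using base j_range by (simp only: delayed_cap order.refl)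
next
  case (step q)
  then have "gap_cap k (level p j (Suc q)) (delayed (p * a + Suc q) j) \<le> hgt k (level p j (Suc q))"
    by (simp add: level_Suc gap_cap_Suc_le_hgt)
  then show ?case using delayed_cap[of j "Suc q" a] step j_range by simp
qed

lemma round_ge_if_start_bounded:
  assumes j_range: "1 \<le> j" "j \<le> m" "j \<le> p * a + 2"
    and start: "- 1 \<le> delayed (p * a + 2) j" "delayed (p * a + 2) j \<le> hgt k (level p j 1)"
    and q_range: "2 \<le> q" "q \<le> Suc (last_cap j)"
  shows "- 1 \<le> delayed (p * a + q) j"
  using q_range
proof (induction q rule: dec_induct)
  case base
  show ?case by (rule start)
next
  case (step q)
  obtain r where q_eq: "q = Suc r" "1 \<le> r" using step(1) by (cases q) auto
  have "delayed (p * a + q) j \<le> hgt k (level p j r)"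
    using start(2) round_le_hgt[OF j_range, of r] step q_eq
    by (cases "r = 1") (auto simp: numeral_2_eq_2)
  then have "- 1 \<le> gap_cap k (level p j q) (delayed (p * a + q) j)"
    using step q_eq by (simp add: level_Suc gap_cap_Suc_ge)
  then show ?case using delayed_cap[of j q a] step j_range by simp
qed

lemma round_end_le_hgt:
  assumes "1 \<le> j" "j \<le> m" "j \<le> p * a + 2"
  shows "delayed (p * a + p) j \<le> hgt k (level p (Suc j) 1)"
proof -
  have "delayed (p * a + Suc (p - 1)) j \<le> hgt k (level p j (p - 1))"
    using p_ge by (intro round_le_hgt assms le_last_cap_if_less) auto
  then show ?thesis
    using p_ge assms(1) level_round_end[of p j] by simp
qed

lemma after_meet_le_hgt:
  assumes "1 \<le> j" "j \<le> m" "j \<le> p * a + 2"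
  shows "delayed (p * a + Suc p) j \<le> hgt k (level p (Suc j) 1)"
proof (cases "j = m")
  case True
  then show ?thesis
    using round_le_hgt[OF assms, of p] hgt_level_m_p hgt_nonneg[of k "level p (Suc j) 1"] p_ge
    by (simp add: last_cap_def)
next
  case False
  moreover have "j \<le> p * a + p" using assms(3) p_ge by linarith
  ultimately show ?thesis using delayed_meet[of j a] round_end_le_hgt[OF assms] assms by simp
qed

lemma round_start_le_hgt:
  assumes "1 \<le> j" "j \<le> m" "j \<le> Suc a"
  shows "delayed (p * a + 2) j \<le> hgt k (level p j 1)"
proof (cases "j = 1")
  case True
  then show ?thesis
    using abs_gap_le_hgt[OF assms(1,2), of "Suc (p * a)"] by (simp add: level_def delayed_def)
next
  case False
  then obtain i where j_eq: "j = Suc i" "1 \<le> i" "i < m" using assms by (cases j) auto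
  then obtain c where a_eq: "a = Suc c" "i \<le> Suc c" using assms(3) by (cases a) auto
  have local_times: "i \<le> p * c + 2" "Suc i \<le> p * c + 2"
    using a_eq(2) p_ge mult_le_mono1[of 1 p c] by linarith+
  have "hgt k (level p (Suc (Suc i)) 1) \<le> hgt k (level p (Suc i) 1)"
    by (rule hgt_antimono) (simp add: level_def)
  then have "delayed (p * c + Suc p) (Suc i) \<le> hgt k (level p j 1)"
    using after_meet_le_hgt[of "Suc i" c] j_eq local_times by simp
  moreover have "delayed (p * c + p) i \<le> hgt k (level p j 1)"
    using round_end_le_hgt[of i c] j_eq local_times by simp
  moreover have "delayed (p * a + 2) j = max (delayed (p * c + p) i) (delayed (p * c + Suc p) (Suc i))"
    unfolding j_eq(1) a_eq(1) using j_eq local_times p_ge by (intro delayed_join) auto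
  ultimately show ?thesis by simp
qed

lemma round_start_ge:
  assumes "1 \<le> j" "j \<le> m" "j \<le> Suc a"
  shows "- 1 \<le> delayed (p * a + 2) j"
  using assms
proof (induction j arbitrary: a rule: dec_induct)
  case base
  then show ?case using delayed_wrap[of a] gap_wrap_ge m_ge by simp
next
  case (step j)
  then obtain c where a_eq: "a = Suc c" "j \<le> Suc c" by (cases a) auto
  have local_time: "j \<le> p * c + 2" using a_eq(2) by (intro le_local_time) auto
  have "- 1 \<le> delayed (p * c + 2) j" using step a_eq by simp
  then have "- 1 \<le> delayed (p * c + p) j"
    using round_ge_if_start_bounded[of j c p] round_start_le_hgt[of j c] step a_eq local_time p_ge
    by (simp add: last_cap_def)
  then show ?case using delayed_join[of j c] step a_eq local_time p_ge by simp
qed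

lemma round_ge_minus_1:
  assumes "1 \<le> j" "j \<le> m" "j \<le> Suc a" "2 \<le> q" "q \<le> Suc (last_cap j)"
  shows "- 1 \<le> delayed (p * a + q) j"
  using assms
  by (intro round_ge_if_start_bounded[OF _ _ _ round_start_ge round_start_le_hgt] le_local_time) auto

lemma after_meet_settled:
  assumes "1 \<le> j" "j \<le> m" "m \<le> Suc a"
  shows "delayed (p * a + Suc p) j \<in> {- 1..0}"
  using assms(2,1)
proof (induction j rule: inc_induct)
  case base
  have "delayed (p * a + Suc p) m \<le> 0"
    using round_le_hgt[of m a p] le_local_time[OF assms(3), of 2] m_ge p_ge hgt_level_m_p
    by (simp add: last_cap_def)
  then show ?case using round_ge_minus_1[of m a "Suc p"] assms(3) m_ge p_ge
    by (simp add: last_cap_def)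
next
  case (step j)
  have "delayed (p * a + Suc p) j = min (delayed (p * a + p) j) (delayed (p * a + Suc p) (Suc j))"
    using step assms(3) p_ge by (intro delayed_meet le_local_time) auto
  moreover have "- 1 \<le> delayed (p * a + p) j"
    using round_ge_minus_1[of j a p] step assms(3) p_ge by (simp add: last_cap_def)
  ultimately show ?case using step by auto
qed

lemma round_start_nonpos:
  assumes "1 \<le> j" "j \<le> m" "m + j \<le> Suc a"
  shows "delayed (p * a + 2) j \<le> 0"
  using assms
proof (induction j arbitrary: a rule: dec_induct)
  case base
  then obtain c where a_eq: "a = Suc c" "m \<le> Suc c" using m_ge by (cases a) auto
  then show ?case
    using delayed_wrap_Suc[of c] after_meet_settled[of 1 c] m_ge by (auto simp: gap_wrap_def)
next
  case (step j)
  then obtain c where a_eq: "a = Suc c" "m + j \<le> Suc c" by (cases a) auto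
  have local_time: "j \<le> p * c + 2" using a_eq(2) by (intro le_local_time) auto
  have "delayed (p * c + 2) j \<le> 0" using step a_eq by simp
  then have "delayed (p * c + p) j \<le> 0"
    using round_le_start[of j c p] step local_time p_ge by (simp add: last_cap_def)
  moreover have "delayed (p * c + Suc p) (Suc j) \<le> 0"
    using after_meet_settled[of "Suc j" c] step a_eq by simp
  ultimately show ?case using delayed_join[of j c] step a_eq local_time p_ge by simp
qed

lemma round_settled:
  assumes "1 \<le> j" "j \<le> m" "m + j \<le> Suc a" "2 \<le> q" "q \<le> Suc p"
  shows "delayed (p * a + q) j \<in> {- 1..0}"
proof (cases "q = Suc p")
  case True
  then show ?thesis using after_meet_settled assms by simp
next
  case False
  then have q_le: "q \<le> Suc (last_cap j)" using assms(5) by (auto simp: last_cap_def)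
  have "delayed (p * a + q) j \<le> delayed (p * a + 2) j"
    using assms q_le by (intro round_le_start le_local_time) auto
  also have "\<dots> \<le> 0" using assms by (intro round_start_nonpos) auto
  finally show ?thesis using round_ge_minus_1[of j a q] assms q_le by simp
qed

end

section \<open>Pairs\<close>

definition pair_meet :: "real \<times> real \<Rightarrow> real \<times> real \<Rightarrow> real \<times> real" where
  "pair_meet x y = (min (fst x) (fst y), max (snd x) (snd y))"

definition pair_join :: "real \<times> real \<Rightarrow> real \<times> real \<Rightarrow> real \<times> real" where
  "pair_join x y = (max (fst x) (fst y), min (snd x) (snd y))"

definition pair_wrap :: "real \<times> real \<Rightarrow> real \<times> real" where
  "pair_wrap x = (max (fst x) (snd x - 1), min (fst x + 1) (snd x))"

definition pair_cap :: "nat \<Rightarrow> nat \<Rightarrow> real \<times> real \<Rightarrow> real \<times> real" where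
  "pair_cap k s x =
    (if s < k then (min (fst x) (snd x + hgt k s), max (fst x - hgt k s) (snd x)) else x)"

lemmas pair_ops_defs = pair_meet_def pair_join_def pair_wrap_def pair_cap_def

definition pair_flip :: "real \<times> real \<Rightarrow> real \<times> real" where
  "pair_flip x = (- snd x, - fst x)"

lemma pair_flip_hom:
  "pair_flip (pair_meet x y) = pair_meet (pair_flip x) (pair_flip y)"
  "pair_flip (pair_join x y) = pair_join (pair_flip x) (pair_flip y)"
  "pair_flip (pair_wrap x) = pair_wrap (pair_flip x)"
  "pair_flip (pair_cap k s x) = pair_cap k s (pair_flip x)"
  by (auto simp: pair_flip_def pair_ops_defs min_def max_def)

definition integral_pair :: "real \<times> real \<Rightarrow> bool" where
  "integral_pair x \<longleftrightarrow> fst x \<in> \<int> \<and> snd x \<in> \<int>"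

lemma integral_pair_ops:
  "\<lbrakk>integral_pair x; integral_pair y\<rbrakk> \<Longrightarrow> integral_pair (pair_meet x y)"
  "\<lbrakk>integral_pair x; integral_pair y\<rbrakk> \<Longrightarrow> integral_pair (pair_join x y)"
  "integral_pair x \<Longrightarrow> integral_pair (pair_wrap x)"
  "integral_pair x \<Longrightarrow> integral_pair (pair_cap k s x)"
  by (auto simp: integral_pair_def pair_ops_defs hgt_def min_def max_def)

text \<open>The pair is within \<open>e\<close> of the pair with sum \<open>\<sigma>\<close> and gap \<open>g\<close>.\<close>

definition tracks :: "real \<Rightarrow> real \<Rightarrow> real \<times> real \<Rightarrow> real \<Rightarrow> bool" where
  "tracks \<sigma> e x g \<longleftrightarrow> \<bar>fst x - (\<sigma> + g) / 2\<bar> \<le> e \<and> \<bar>snd x - (\<sigma> - g) / 2\<bar> \<le> e"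

lemma tracks_ops:
  "\<lbrakk>tracks \<sigma> e x g; tracks \<sigma> e y h\<rbrakk> \<Longrightarrow> tracks \<sigma> e (pair_meet x y) (min g h)"
  "\<lbrakk>tracks \<sigma> e x g; tracks \<sigma> e y h\<rbrakk> \<Longrightarrow> tracks \<sigma> e (pair_join x y) (max g h)"
  "tracks \<sigma> e x g \<Longrightarrow> tracks \<sigma> e (pair_wrap x) (gap_wrap g)"
  "tracks \<sigma> e x g \<Longrightarrow> tracks \<sigma> e (pair_cap k s x) (gap_cap k s g)"
  by (auto simp: tracks_def pair_ops_defs gap_wrap_def gap_cap_def min_def max_def abs_le_iff
      field_simps)

lemma Ints_le_if_less: "x \<in> \<int> \<Longrightarrow> y \<in> \<int> \<Longrightarrow> x < y + 1 \<Longrightarrow> x \<le> (y :: real)"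
  by (auto elim!: Ints_cases)

lemma integral_pair_settled:
  assumes "integral_pair x" "tracks (2 * v + 3 / 2) (1 / 4) x g" "v \<in> \<int>" "g \<in> {- 1..0}"
  shows "fst x \<in> {v..v + 1}" "snd x = v + 1"
proof -
  have Ints: "fst x \<in> \<int>" "snd x \<in> \<int>" "v + 1 \<in> \<int>"
    using assms(1,3) by (auto simp: integral_pair_def)
  have "v < fst x + 1" "fst x < v + 1 + 1" "v + 1 < snd x + 1" "snd x < v + 1 + 1"
    using assms(2,4) by (auto simp: tracks_def abs_le_iff field_simps)
  then show "fst x \<in> {v..v + 1}" "snd x = v + 1"
    using Ints assms(3) by (auto intro!: antisym Ints_le_if_less)
qed

locale tracked_pairs =
  pairs: column_evolution p m pair_meet pair_join pair_wrap "pair_cap k" W + gap_evolution p m k G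
  for p m k :: nat and W :: "nat \<Rightarrow> nat \<Rightarrow> real \<times> real" and G :: "nat \<Rightarrow> nat \<Rightarrow> real" +
  fixes v :: real
  assumes v_Ints: "v \<in> \<int>"
    and integral_0: "\<lbrakk>1 \<le> j; j \<le> m\<rbrakk> \<Longrightarrow> integral_pair (W 0 j)"
    and tracks_0: "\<lbrakk>1 \<le> j; j \<le> m\<rbrakk> \<Longrightarrow> tracks (2 * v + 3 / 2) (1 / 4) (W 0 j) (G 0 j)"
begin

lemma settled_pair:
  assumes j_range: "1 \<le> j" "j \<le> m" and "delayed t j \<in> {- 1..0}"
  shows "fst (pairs.delayed t j) \<in> {v..v + 1}" "snd (pairs.delayed t j) = v + 1"
proof -
  have "integral_pair (pairs.delayed t j)"
    unfolding pairs.delayed_def using integral_0 integral_pair_ops j_range by (rule pairs.invariant)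
  moreover have "tracks (2 * v + 3 / 2) (1 / 4) (pairs.delayed t j) (delayed t j)"
    unfolding pairs.delayed_def delayed_def
    by (rule column_evolution_rel[OF pairs.column_evolution_axioms column_evolution_axioms])
      (fact tracks_0 tracks_ops j_range)+
  ultimately show "fst (pairs.delayed t j) \<in> {v..v + 1}" "snd (pairs.delayed t j) = v + 1"
    using integral_pair_settled[OF _ _ v_Ints assms(3)] by blast+
qed

definition lower :: "nat \<Rightarrow> nat \<Rightarrow> real" where
  "lower t j = fst (pairs.delayed t j)"

lemma lower_meet:
  assumes "m \<le> a" "1 \<le> j" "j < m"
  shows "lower (p * a + Suc p) j = min (lower (p * a + p) j) (lower (p * a + Suc p) (Suc j))"
  using pairs.delayed_meet[of j a] le_local_time[of j a p] assms p_ge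
  by (simp add: lower_def pair_meet_def)

lemma lower_join:
  assumes "m \<le> a" "1 \<le> j" "j < m"
  shows "lower (p * Suc a + 2) (Suc j) = max (lower (p * a + p) j) (lower (p * a + Suc p) (Suc j))"
  using pairs.delayed_join[of j a] le_local_time[of j a p] assms p_ge
  by (simp add: lower_def pair_join_def)

lemma lower_wrap:
  assumes "m \<le> Suc a"
  shows "lower (p * Suc a + 2) 1 = lower (p * a + Suc p) 1"
  using settled_pair[of 1 "p * a + Suc p"] after_meet_settled[of 1 a] m_ge assms
    pairs.delayed_wrap_Suc[of a]
  by (simp add: lower_def pair_wrap_def)

lemma lower_cap_le:
  assumes "m \<le> Suc a" "1 \<le> j" "j \<le> m" "2 \<le> q" "q \<le> last_cap j"
  shows "lower (p * a + Suc q) j \<le> lower (p * a + q) j"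
  using pairs.delayed_cap[of j q a] le_local_time[of j a q] assms
  by (simp add: lower_def pair_cap_def)

lemma lower_after_meet_le:
  assumes "m \<le> a" "1 \<le> j" "j \<le> m"
  shows "lower (p * a + Suc p) j \<le> lower (p * a + p) j"
  using lower_meet[of a j] lower_cap_le[of a j p] assms p_ge
  by (cases "j = m") (auto simp: last_cap_def)

lemma lower_round_const:
  assumes "m + j \<le> Suc a" "1 \<le> j" "j \<le> m" "2 \<le> q" "q \<le> Suc (last_cap j)"
  shows "lower (p * a + q) j = lower (p * a + 2) j"
  using assms(4,5)
proof (induction q rule: dec_induct)
  case (step q)
  have "q \<le> Suc p" using step last_cap_le[of j] by simp
  then have "fst (pairs.delayed (p * a + q) j) \<in> {v..v + 1}" "snd (pairs.delayed (p * a + q) j) = v + 1"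
    using settled_pair[of j "p * a + q"] round_settled[of j a q] assms step(1) by auto
  then have "lower (p * a + Suc q) j = lower (p * a + q) j"
    using pairs.delayed_cap[of j q a] le_local_time[of j a q] assms step hgt_nonneg[of k "level p j q"]
    by (simp add: lower_def pair_cap_def)
  then show ?case using step by simp
qed simp

lemma lower_round_end: "\<lbrakk>m + j \<le> Suc a; 1 \<le> j; j \<le> m\<rbrakk> \<Longrightarrow> lower (p * a + p) j = lower (p * a + 2) j"
  using lower_round_const[of j a p] p_ge by (simp add: last_cap_def)

lemma lower_sorted:
  assumes "1 \<le> j" "j < m" "m + j \<le> a"
  shows "lower (p * a + 2) j \<le> lower (p * a + 2) (Suc j)"
  using assms
proof (induction j arbitrary: a rule: dec_induct)
  case base
  then obtain c where a_eq: "a = Suc c" "m \<le> c" by (cases a) auto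
  have "lower (p * a + 2) 1 = lower (p * c + Suc p) 1"
    unfolding a_eq(1) using a_eq(2) by (intro lower_wrap) simp
  also have "\<dots> \<le> lower (p * c + p) 1"
    using a_eq(2) m_ge by (intro lower_after_meet_le) auto
  also have "\<dots> \<le> lower (p * a + 2) (Suc 1)"
    using lower_join[of c 1] a_eq base by simp
  finally show ?case .
next
  case (step j)
  then obtain c where a_eq: "a = Suc c" "m + j \<le> c" by (cases a) auto
  have "lower (p * c + p) j \<le> lower (p * c + p) (Suc j)"
    using step a_eq lower_round_end[of j c] lower_round_end[of "Suc j" c] by simp
  moreover have "lower (p * c + Suc p) (Suc j) \<le> lower (p * c + p) (Suc j)"
    using step a_eq by (intro lower_after_meet_le) auto
  ultimately have "lower (p * a + 2) (Suc j) \<le> lower (p * c + p) (Suc j)"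
    using lower_join[of c j] step a_eq by simp
  also have "\<dots> \<le> lower (p * a + 2) (Suc (Suc j))"
    using lower_join[of c "Suc j"] step a_eq by simp
  finally show ?case .
qed

lemma lower_after_meet_const:
  assumes "1 \<le> j" "j \<le> m" "2 * m \<le> Suc a"
  shows "lower (p * a + Suc p) j = lower (p * a + 2) j"
  using assms(2,1)
proof (induction j rule: inc_induct)
  case base
  show ?case using lower_round_const[of m a "Suc p"] assms p_ge m_ge by (simp add: last_cap_def)
next
  case (step j)
  have "lower (p * a + Suc p) j = min (lower (p * a + p) j) (lower (p * a + Suc p) (Suc j))"
    using step assms(3) by (intro lower_meet) auto
  then show ?case using step lower_round_end[of j a] lower_sorted[of j a] assms(3) by simp
qed

lemma lower_next_round:
  assumes "1 \<le> j" "j \<le> m" "2 * m \<le> Suc a"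
  shows "lower (p * Suc a + 2) j = lower (p * a + 2) j"
proof (cases "j = 1")
  case True
  then show ?thesis using lower_wrap[of a] lower_after_meet_const[OF assms] assms m_ge by simp
next
  case False
  then obtain i where j_eq: "j = Suc i" "1 \<le> i" "i < m" using assms by (cases j) auto
  then have "lower (p * Suc a + 2) j = max (lower (p * a + 2) i) (lower (p * a + 2) (Suc i))"
    using lower_join[of a i] lower_round_end[of i a] lower_after_meet_const[of "Suc i" a] assms by simp
  then show ?thesis using lower_sorted[of i a] j_eq assms by simp
qed

lemma lower_stationary:
  assumes "1 \<le> j" "j \<le> m" "2 * m \<le> Suc a" "2 \<le> q" "q \<le> Suc p"
  shows "lower (p * a + q) j = lower (p * (2 * m - 1) + 2) j"
proof -
  have "lower (p * a + q) j = lower (p * a + 2) j"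
    using lower_after_meet_const[of j a] lower_round_const[of j a q] assms
    by (cases "q = Suc p") (auto simp: last_cap_def)
  also have "2 * m - 1 \<le> a" using assms(3) by simp
  then have "lower (p * a + 2) j = lower (p * (2 * m - 1) + 2) j"
    by (induction a rule: dec_induct) (use lower_next_round assms in auto)
  finally show ?thesis .
qed

lemma end_time_column_1: "p * (2 * m - 1) + 1 = p * (2 * m - 2) + Suc p"
  using m_ge by (cases m) auto

lemma end_time_cases:
  assumes "2 \<le> j"
  obtains a q where "p * (2 * m - 1) + j = p * a + q" "2 * m \<le> Suc a" "2 \<le> q" "q \<le> Suc p"
proof
  show "p * (2 * m - 1) + j = p * (2 * m - 1 + (j - 2) div p) + ((j - 2) mod p + 2)"
    using assms mult_div_mod_eq[of p "j - 2"] by (simp only: distrib_left)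
  show "(j - 2) mod p + 2 \<le> Suc p"
    using p_ge mod_less_divisor[of p "j - 2"] by linarith
qed auto

lemma settled_at_end:
  assumes "1 \<le> j" "j \<le> m"
  shows "delayed (p * (2 * m - 1) + j) j \<in> {- 1..0}"
proof (cases "j = 1")
  case True
  then show ?thesis
    using after_meet_settled[of 1 "2 * m - 2"] m_ge by (simp only: end_time_column_1)
next
  case False
  then obtain a q where "p * (2 * m - 1) + j = p * a + q" "2 * m \<le> Suc a" "2 \<le> q" "q \<le> Suc p"
    using end_time_cases[of j] assms(1) by auto
  then show ?thesis using round_settled[of j a q] assms by simp
qed

lemma lower_at_end:
  assumes "1 \<le> j" "j \<le> m" "2 \<le> m"
  shows "lower (p * (2 * m - 1) + j) j = lower (p * (2 * m - 1) + 2) j"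
proof (cases "j = 1")
  case True
  have "Suc (2 * m - 2) = 2 * m - 1" using assms(3) by simp
  then show ?thesis
    using lower_wrap[of "2 * m - 2"] assms(3) True by (simp only: end_time_column_1)
next
  case False
  then obtain a q where "p * (2 * m - 1) + j = p * a + q" "2 * m \<le> Suc a" "2 \<le> q" "q \<le> Suc p"
    using end_time_cases[of j] assms(1) by auto
  then show ?thesis using lower_stationary[of j a q] assms by simp
qed

lemma pair_at_end:
  assumes "1 \<le> j" "j \<le> m"
  shows "fst (W (p * (2 * m - 1)) j) \<in> {v..v + 1}" "snd (W (p * (2 * m - 1)) j) = v + 1"
  using settled_pair[OF assms settled_at_end[OF assms]] by (simp_all add: pairs.delayed_def)

lemma sorted_at_end:
  assumes "1 \<le> j" "j < m"
  shows "fst (W (p * (2 * m - 1)) j) \<le> fst (W (p * (2 * m - 1)) (Suc j))"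
proof -
  have "lower (p * (2 * m - 1) + 2) j \<le> lower (p * (2 * m - 1) + 2) (Suc j)"
    using assms by (intro lower_sorted) auto
  then have "lower (p * (2 * m - 1) + j) j \<le> lower (p * (2 * m - 1) + Suc j) (Suc j)"
    using lower_at_end[of j] lower_at_end[of "Suc j"] assms by simp
  then show ?thesis by (simp add: lower_def pairs.delayed_def)
qed

end

section \<open>The maps \<open>Q\<^sub>x\<close>\<close>

definition moves :: "((nat \<Rightarrow> real) \<Rightarrow> nat \<Rightarrow> real) \<Rightarrow> nat \<Rightarrow> bool" where
  "moves g t \<longleftrightarrow> (\<exists>c. g c t \<noteq> c t)"

lemma moves_cyc:
  assumes "1 \<le> m" "t \<in> {1, 2 * m}"
  shows "moves (cyc (2 * m)) t"
proof -
  have "cyc (2 * m) ((\<lambda>_. 0)(2 * m := 2)) t \<noteq> ((\<lambda>_. 0)(2 * m := 2)) t"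
    using assms by (auto simp: cyc_def)
  then show ?thesis unfolding moves_def by blast
qed

lemma moves_mov:
  assumes "1 \<le> j" "j \<le> m" "t \<in> {j, j + 1, 2 * m - j, 2 * m - j + 1}"
  shows "moves (mov (2 * m) j) t"
proof -
  define c :: "nat \<Rightarrow> real" where "c = (\<lambda>_. 0)(t := if t \<in> {j, 2 * m - j} then 1 else - 1)"
  have "mov (2 * m) j c t \<noteq> c t"
    using assms by (auto simp: mov_def c_def)
  then show ?thesis unfolding moves_def by blast
qed

lemma moves_dec:
  assumes "1 \<le> j" "j \<le> m" "t \<in> {j, 2 * m - j + 1}"
  shows "moves (dec (2 * m) k j s) t"
proof -
  define c :: "nat \<Rightarrow> real" where "c = (\<lambda>_. 0)(j := hgt k s + 1)"
  have "dec (2 * m) k j s c t \<noteq> c t"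
    using assms hgt_nonneg[of k s] by (auto simp: dec_def c_def)
  then show ?thesis unfolding moves_def by blast
qed

lemma foldr_comp_unmoved:
  assumes "\<And>h. h \<in> set hs \<Longrightarrow> \<not> moves h t"
  shows "foldr (\<circ>) hs g c t = g c t"
  using assms
proof (induction hs)
  case (Cons h hs)
  have "foldr (\<circ>) (h # hs) g c t = h (foldr (\<circ>) hs g c) t" by simp
  also have "\<dots> = foldr (\<circ>) hs g c t" using Cons.prems[of h] by (simp add: moves_def)
  also have "\<dots> = g c t" by (rule Cons.IH) (simp add: Cons.prems)
  finally show ?case .
qed simp

lemma Qmap_unmoved:
  assumes "4 \<le> p" "p \<le> k" "\<And>g. g \<in> Q p k x \<Longrightarrow> \<not> moves g t"
  shows "Qmap p k x c t = c t"
proof -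
  obtain hs where set_hs: "set hs = Q p k x" "distinct hs"
    using finite_distinct_list[OF finite_Q] by blast
  then have "Qmap p k x = foldr (\<circ>) hs id"
    using assms by (intro Qmap_any_order) auto
  then show ?thesis using foldr_comp_unmoved[of hs t id] set_hs assms(3) by simp
qed

lemma Qmap_moved:
  assumes "4 \<le> p" "p \<le> k" "g \<in> Q p k x" "moves g t"
  shows "Qmap p k x c t = g c t"
proof -
  obtain hs where set_hs: "set hs = Q p k x - {g}" "distinct hs"
    using finite_distinct_list[of "Q p k x - {g}"] finite_Q by auto
  have "Qmap p k x = foldr (\<circ>) (hs @ [g]) id"
    using set_hs assms by (intro Qmap_any_order) auto
  moreover have "\<not> moves h t" if "h \<in> set hs" for h
  proof -
    have "h \<in> Q p k x" "g \<noteq> h" using that set_hs by auto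
    then obtain A B where "acts_on g A" "acts_on h B" "A \<inter> B = {}"
      using Q_disjoint[OF assms(1-3)] by metis
    then show ?thesis using assms(4) unfolding acts_on_def moves_def by blast
  qed
  ultimately show ?thesis using foldr_comp_unmoved[of hs t g] by simp
qed

lemma blk_bounds:
  assumes "4 \<le> p" "p \<le> k" "blk p k = 2 * m"
  shows "(p - 2) * (m - 1) + 2 < k" "k \<le> (p - 2) * m + 2"
proof -
  define r where "r = (real k - 2) / (real p - 2)"
  have m_eq: "m = nat \<lceil>r\<rceil>" using assms(3) unfolding blk_def r_def by simp
  have r_pos: "r > 0" unfolding r_def using assms by simp
  have k_minus_2_eq: "real k - 2 = real (p - 2) * r" unfolding r_def using assms
    by (simp add: of_nat_diff)
  have "real (p - 2) * r \<le> real (p - 2) * real m"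
    using m_eq by (intro mult_left_mono) linarith+
  then have "real k \<le> real ((p - 2) * m + 2)" using k_minus_2_eq by simp
  then show "k \<le> (p - 2) * m + 2" by linarith
  have "real (p - 2) * real (m - 1) < real (p - 2) * r"
    using assms(1) m_eq r_pos by (intro mult_strict_left_mono) linarith+
  then have "real ((p - 2) * (m - 1) + 2) < real k"
    using k_minus_2_eq by (simp only: of_nat_add of_nat_mult of_nat_numeral)
  then show "(p - 2) * (m - 1) + 2 < k" by linarith
qed

lemma le_ratio_iff_level_less:
  assumes "4 \<le> p" "p \<le> k" "1 \<le> j"
  shows "real j \<le> (real k - 2) / (real p - 2) \<longleftrightarrow> level p j p < k"
proof -
  have "real j \<le> (real k - 2) / (real p - 2) \<longleftrightarrow> real j * (real p - 2) \<le> real k - 2"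
    using assms by (simp add: pos_le_divide_eq)
  also have "\<dots> \<longleftrightarrow> real ((p - 2) * j + 2) \<le> real k"
    using assms by (simp add: of_nat_diff algebra_simps)
  also have "\<dots> \<longleftrightarrow> (p - 2) * j + 2 \<le> k" by (simp only: of_nat_le_iff)
  also have "\<dots> \<longleftrightarrow> level p j p < k"
    using assms level_p[of p j] by auto
  finally show ?thesis .
qed

text \<open>The \<open>n\<close>-th step, counted from \<open>0\<close>, applies \<open>Q\<^sub>x\<close> with \<open>x = n mod p + 1\<close>, so that
  \<open>x + j - 1 \<equiv> n + j\<close> modulo \<open>p\<close>.\<close>

lemma mod_index: "(n mod p + 1 + j - 1) mod p = (n + j) mod (p :: nat)"
  by (simp add: mod_add_left_eq)

lemma cong_index_iff: "[n mod p + 1 + j = 1] (mod p) \<longleftrightarrow> (n + j) mod p = (0 :: nat)"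
proof -
  have "[n mod p + 1 + j = 1] (mod p) \<longleftrightarrow> [n mod p + j = 0] (mod p)"
    using cong_add_rcancel_nat[of "n mod p + j" 1 0 p] by (simp add: ac_simps)
  then show ?thesis by (simp add: cong_def mod_add_left_eq)
qed

lemma mod_index_notin_iff:
  assumes "4 \<le> p"
  shows "(n mod p + 1 + j) mod p \<notin> {1, 2} \<longleftrightarrow> 2 \<le> (n + j) mod (p :: nat)"
proof -
  define r where "r = (n + j) mod p"
  have "(n mod p + 1 + j) mod p = Suc (n + j) mod p"
    using mod_add_left_eq[of n p "Suc j"] by simp
  also have "\<dots> = (if Suc r = p then 0 else Suc r)"
    unfolding r_def by (rule mod_Suc)
  finally show ?thesis
    using assms unfolding r_def[symmetric] by auto
qed

lemma MV_index:
  assumes "4 \<le> p" "p \<le> k" "blk p k = 2 * m"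
  shows "MV p k (n mod p + 1) =
    {mov (2 * m) j | j. 1 \<le> j \<and> j \<le> m \<and> level p j p < k \<and> (n + j) mod p = 0}"
proof -
  have "real j \<le> (real k - 2) / (real p - 2) \<longleftrightarrow> j \<le> m \<and> level p j p < k" if "1 \<le> j" for j
    using blk_half[OF assms(1,2), of j] le_ratio_iff_level_less[OF assms(1,2) that] assms(3) by auto
  then show ?thesis
    unfolding MV_def assms(3) cong_index_iff by (intro Collect_cong ex_cong1) auto
qed

lemma DC_index:
  assumes "4 \<le> p" "p \<le> k" "blk p k = 2 * m"
  shows "DC p k (n mod p + 1) =
    {dec (2 * m) k j (level p j ((n + j) mod p)) | j.
      1 \<le> j \<and> j \<le> m \<and> 2 \<le> (n + j) mod p \<and> level p j ((n + j) mod p) < k}"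
proof -
  have index_iff: "int s = (int p - 2) * (int j - 1) - 1 + int ((n + j) mod p) \<and> s \<le> k - 1 \<longleftrightarrow>
      s = level p j ((n + j) mod p) \<and> level p j ((n + j) mod p) < k"
    if "1 \<le> j" "2 \<le> (n + j) mod p" for j s
  proof -
    have "(int p - 2) * (int j - 1) - 1 + int ((n + j) mod p) = int (level p j ((n + j) mod p))"
      using assms(1) that unfolding level_def by (simp add: of_nat_diff)
    then show ?thesis using assms(1,2) by auto
  qed
  have "DC p k (n mod p + 1) =
    {dec (2 * m) k j s | j s. 1 \<le> j \<and> j \<le> m \<and> 2 \<le> (n + j) mod p \<and>
      s = level p j ((n + j) mod p) \<and> level p j ((n + j) mod p) < k}"
    unfolding DC_def assms(3) mod_index mod_index_notin_iff[OF assms(1)]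
    using index_iff by (intro Collect_cong ex_cong1) auto
  then show ?thesis by blast
qed

subsection \<open>Pairs of coordinates\<close>

definition pair_at :: "nat \<Rightarrow> (nat \<Rightarrow> real) \<Rightarrow> nat \<Rightarrow> real \<times> real" where
  "pair_at m c j = (c j, c (2 * m - j + 1))"

lemma pair_at_Qmap_moved:
  assumes "4 \<le> p" "p \<le> k" "g \<in> Q p k x" "moves g j" "moves g (2 * m - j + 1)"
  shows "pair_at m (Qmap p k x c) j = pair_at m (g c) j"
  using Qmap_moved[OF assms(1-3)] assms(4,5) unfolding pair_at_def by simp

lemma pair_at_mov:
  assumes "1 \<le> j" "j < m"
  shows "pair_at m (mov (2 * m) j c) j = pair_meet (pair_at m c j) (pair_at m c (Suc j))"
    and "pair_at m (mov (2 * m) j c) (Suc j) = pair_join (pair_at m c j) (pair_at m c (Suc j))"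
proof -
  have "2 * m - Suc j + 1 = 2 * m - j" using assms by simp
  then show "pair_at m (mov (2 * m) j c) j = pair_meet (pair_at m c j) (pair_at m c (Suc j))"
    "pair_at m (mov (2 * m) j c) (Suc j) = pair_join (pair_at m c j) (pair_at m c (Suc j))"
    using assms by (auto simp: pair_at_def mov_def pair_meet_def pair_join_def)
qed

lemma pair_at_mov_middle:
  assumes "1 \<le> m" "s < k" "k \<le> Suc s"
  shows "pair_at m (mov (2 * m) m c) m = pair_cap k s (pair_at m c m)"
  using assms by (auto simp: pair_at_def mov_def pair_cap_def hgt_eq_0)

lemma pair_at_dec:
  assumes "1 \<le> j" "j \<le> m" "s < k"
  shows "pair_at m (dec (2 * m) k j s c) j = pair_cap k s (pair_at m c j)"
  using assms by (auto simp: pair_at_def dec_def pair_cap_def)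

lemma pair_at_cyc: "1 \<le> m \<Longrightarrow> pair_at m (cyc (2 * m) c) 1 = pair_wrap (pair_at m c 1)"
  by (auto simp: pair_at_def cyc_def pair_wrap_def)

context
  fixes p k m n :: nat
  assumes p_le: "4 \<le> p" "p \<le> k" and blk_eq: "blk p k = 2 * m"
begin

lemma Q_index_cases:
  assumes "g \<in> Q p k (n mod p + 1)"
  obtains (cyc) "n mod p = 0" "g = cyc (2 * m)"
  | (mov) i where "g = mov (2 * m) i" "1 \<le> i" "i \<le> m" "level p i p < k" "(n + i) mod p = 0"
  | (dec) i where "g = dec (2 * m) k i (level p i ((n + i) mod p))" "1 \<le> i" "i \<le> m"
      "2 \<le> (n + i) mod p" "level p i ((n + i) mod p) < k"
  using assms unfolding Q_def MV_index[OF p_le blk_eq] DC_index[OF p_le blk_eq] blk_eq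
  by (auto split: if_splits)

lemma pair_at_Qmap_mov:
  assumes "1 \<le> i" "i \<le> m" "level p i p < k" "(n + i) mod p = 0" "j \<in> {i, Suc i}" "j \<le> m"
  shows "pair_at m (Qmap p k (n mod p + 1) c) j = pair_at m (mov (2 * m) i c) j"
proof (rule pair_at_Qmap_moved[OF p_le])
  have "mov (2 * m) i \<in> MV p k (n mod p + 1)"
    unfolding MV_index[OF p_le blk_eq] mem_Collect_eq using assms(1-4) by (intro exI[of _ i]) simp
  then show "mov (2 * m) i \<in> Q p k (n mod p + 1)"
    by (simp add: Q_def)
  show "moves (mov (2 * m) i) j" "moves (mov (2 * m) i) (2 * m - j + 1)"
    using assms by (auto intro!: moves_mov)
qed

lemma pair_at_Qmap_dec:
  assumes "1 \<le> j" "j \<le> m" "2 \<le> (n + j) mod p" "level p j ((n + j) mod p) < k"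
  shows "pair_at m (Qmap p k (n mod p + 1) c) j =
    pair_at m (dec (2 * m) k j (level p j ((n + j) mod p)) c) j"
proof (rule pair_at_Qmap_moved[OF p_le])
  have "dec (2 * m) k j (level p j ((n + j) mod p)) \<in> DC p k (n mod p + 1)"
    unfolding DC_index[OF p_le blk_eq] mem_Collect_eq using assms by (intro exI[of _ j]) simp
  then show "dec (2 * m) k j (level p j ((n + j) mod p)) \<in> Q p k (n mod p + 1)"
    by (simp add: Q_def)
qed (use assms in \<open>auto intro!: moves_dec\<close>)

lemma pair_at_Qmap_cyc:
  assumes "1 \<le> m" "n mod p = 0"
  shows "pair_at m (Qmap p k (n mod p + 1) c) 1 = pair_at m (cyc (2 * m) c) 1"
proof (rule pair_at_Qmap_moved[OF p_le])
  show "cyc (2 * m) \<in> Q p k (n mod p + 1)"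
    unfolding Q_def blk_eq using assms(2) by simp
qed (use assms in \<open>auto intro!: moves_cyc\<close>)

lemma pair_at_Qmap_idle:
  assumes j_range: "1 \<le> j" "j \<le> m"
    and idle: "(n + j) mod p = 0 \<and> j = m \<and> k \<le> level p m p \<or>
      2 \<le> (n + j) mod p \<and> k \<le> level p j ((n + j) mod p)"
  shows "pair_at m (Qmap p k (n mod p + 1) c) j = pair_at m c j"
proof -
  have "\<not> moves g t"
    if g_in_Q: "g \<in> Q p k (n mod p + 1)" and t_in_column: "t \<in> {j, 2 * m - j + 1}" for g t
  proof -
    show ?thesis
      using g_in_Q
    proof (cases rule: Q_index_cases)
      case cyc
      then have "(n + 1) mod p = 1" using p_le by (simp add: mod_Suc)
      then have "j \<noteq> 1" using idle by auto
      then have "t \<noteq> 1" "t \<noteq> 2 * m" using t_in_column j_range by auto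
      then show ?thesis unfolding cyc(2) moves_def cyc_def by simp
    next
      case (mov i)
      then have "(n + Suc i) mod p = 1" using p_le by (simp add: mod_Suc)
      then have "j \<noteq> i" "j \<noteq> Suc i" using idle mov by auto
      then have "t \<notin> {i, 2 * m - i}" "t \<notin> {i + 1, 2 * m - i + 1}"
        using mov(2,3) t_in_column j_range by auto
      then show ?thesis unfolding mov(1) moves_def mov_def by simp
    next
      case (dec i)
      then have "j \<noteq> i" using idle by auto
      then have "t \<noteq> i" "t \<noteq> 2 * m - i + 1" using dec(2,3) t_in_column j_range by auto
      then show ?thesis unfolding dec(1) moves_def dec_def by simp
    qed
  qed
  then show ?thesis unfolding pair_at_def by (simp add: Qmap_unmoved[OF p_le])
qed

lemma level_p_less:
  assumes "1 \<le> i" "i < m"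
  shows "level p i p < k"
proof -
  have "(p - 2) * i \<le> (p - 2) * (m - 1)" using assms by (intro mult_le_mono2) simp
  then show ?thesis using blk_bounds(1)[OF p_le blk_eq] level_p[of p i] assms p_le by linarith
qed

lemma pair_at_Qmap_middle:
  assumes "1 \<le> m" "(n + m) mod p = 0"
  shows "pair_at m (Qmap p k (n mod p + 1) c) m = pair_cap k (level p m p) (pair_at m c m)"
proof (cases "level p m p < k")
  case True
  moreover have "k \<le> Suc (level p m p)"
    using blk_bounds(2)[OF p_le blk_eq] level_p[of p m] assms(1) p_le by linarith
  ultimately show ?thesis
    using pair_at_Qmap_mov[of m m] pair_at_mov_middle[of m "level p m p" k] assms by simp
next
  case False
  then show ?thesis using pair_at_Qmap_idle[of m] assms by (simp add: pair_cap_def)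
qed

lemma pair_at_Qmap_cap:
  assumes "1 \<le> j" "j \<le> m" "2 \<le> (n + j) mod p"
  shows "pair_at m (Qmap p k (n mod p + 1) c) j =
    pair_cap k (level p j ((n + j) mod p)) (pair_at m c j)"
proof (cases "level p j ((n + j) mod p) < k")
  case True
  then show ?thesis using pair_at_Qmap_dec[OF assms] pair_at_dec[OF assms(1,2)] by simp
next
  case False
  then show ?thesis using pair_at_Qmap_idle[OF assms(1,2)] assms(3) by (simp add: pair_cap_def)
qed

lemma pair_at_Qmap_exchange:
  assumes "1 \<le> i" "i < m" "(n + i) mod p = 0"
  shows "pair_at m (Qmap p k (n mod p + 1) c) i = pair_meet (pair_at m c i) (pair_at m c (Suc i))"
    and "pair_at m (Qmap p k (n mod p + 1) c) (Suc i) =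
      pair_join (pair_at m c i) (pair_at m c (Suc i))"
  using pair_at_Qmap_mov[of i i] pair_at_Qmap_mov[of i "Suc i"] level_p_less pair_at_mov assms by simp_all

lemma pair_at_Qmap:
  assumes "1 \<le> j" "j \<le> m"
  shows "pair_at m (Qmap p k (n mod p + 1) c) j =
    column_step p m pair_meet pair_join pair_wrap (pair_cap k) n (pair_at m c) j"
proof -
  consider (meet) "(n + j) mod p = 0" "j < m" | (middle) "(n + j) mod p = 0" "j = m"
    | (wrap_or_join) "(n + j) mod p = 1" | (cap) "2 \<le> (n + j) mod p"
    using assms(2) by linarith
  then show ?thesis
  proof cases
    case meet
    then show ?thesis using pair_at_Qmap_exchange(1) assms(1) by (simp add: column_step_def)
  next
    case middle
    then show ?thesis using pair_at_Qmap_middle assms(1) by (simp add: column_step_def)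
  next
    case wrap_or_join
    obtain i where Suc_i: "j = Suc i" using assms(1) by (cases j) auto
    then have n_i: "(n + i) mod p = 0"
      using wrap_or_join by (metis One_nat_def Suc_inject add_Suc_right mod_Suc zero_neq_one)
    show ?thesis
    proof (cases "i = 0")
      case True
      then show ?thesis
        using pair_at_Qmap_cyc pair_at_cyc[of m] Suc_i n_i wrap_or_join assms
        by (simp add: column_step_def)
    next
      case False
      then show ?thesis
        using pair_at_Qmap_exchange(2)[of i] Suc_i n_i wrap_or_join assms
        by (simp add: column_step_def)
    qed
  next
    case cap
    then show ?thesis using pair_at_Qmap_cap[OF assms cap] by (simp add: column_step_def)
  qed
qed

end

section \<open>Orbits of 2-flat sequences\<close>

primrec orbit :: "nat \<Rightarrow> nat \<Rightarrow> (nat \<Rightarrow> real) \<Rightarrow> nat \<Rightarrow> nat \<Rightarrow> real" where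
  "orbit p k c 0 = c"
| "orbit p k c (Suc n) = Qmap p k (n mod p + 1) (orbit p k c n)"

lemma column_evolution_orbit:
  assumes "4 \<le> p" "p \<le> k" "blk p k = 2 * m"
  shows "column_evolution p m pair_meet pair_join pair_wrap (pair_cap k)
    (\<lambda>n. pair_at m (orbit p k c n))"
  by unfold_locales (use pair_at_Qmap[OF assms] assms(1) in simp_all)

primrec gap_orbit :: "nat \<Rightarrow> nat \<Rightarrow> nat \<Rightarrow> (nat \<Rightarrow> real) \<Rightarrow> nat \<Rightarrow> nat \<Rightarrow> real" where
  "gap_orbit p m k d 0 = d"
| "gap_orbit p m k d (Suc n) = column_step p m min max gap_wrap (gap_cap k) n (gap_orbit p m k d n)"

lemma gap_evolution_gap_orbit:
  assumes "4 \<le> p" "p \<le> k" "blk p k = 2 * m"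
    and "\<And>j. \<lbrakk>1 \<le> j; j \<le> m\<rbrakk> \<Longrightarrow> \<bar>d j\<bar> \<le> hgt k 0"
  shows "gap_evolution p m k (gap_orbit p m k d)"
  by unfold_locales (use assms(1,4) blk_bounds[OF assms(1-3)] in simp_all)

lemma flat_mono:
  assumes "flat m a" "1 \<le> i" "i \<le> j" "j \<le> m"
  shows "a i \<le> a j"
  using assms(3,2,4)
proof (induction j rule: dec_induct)
  case (step j)
  then have "a j \<le> a (j + 1)" using assms(1) unfolding flat_def by simp
  then show ?case using step by simp
qed simp

lemma flat_spread:
  assumes "flat m a" "1 \<le> i" "i \<le> m" "1 \<le> j" "j \<le> m"
  shows "a j \<le> a i + 1"
proof -
  have "a j \<le> a m" "a 1 \<le> a i" "a m \<le> a 1 + 1"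
    using flat_mono[OF assms(1)] assms unfolding flat_def by auto
  then show ?thesis by linarith
qed

lemma flat_antidiagonal_sums:
  assumes "flat m a" "flat m e" "1 \<le> r" "r \<le> m" "1 \<le> s" "s \<le> m"
  shows "a r + e (m + 1 - r) \<le> a s + e (m + 1 - s) + 1"
proof (cases "r \<le> s")
  case True
  then have "a r \<le> a s" using flat_mono[OF assms(1)] assms(3,6) by simp
  moreover have "e (m + 1 - r) \<le> e (m + 1 - s) + 1"
    using assms(3-6) by (intro flat_spread[OF assms(2)]) auto
  ultimately show ?thesis by linarith
next
  case False
  then have "e (m + 1 - r) \<le> e (m + 1 - s)"
    using assms(3-6) by (intro flat_mono[OF assms(2)]) auto
  moreover have "a r \<le> a s + 1" using assms(3-6) by (intro flat_spread[OF assms(1)])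
  ultimately show ?thesis by linarith
qed

lemma pair_sum_odd_even:
  fixes c :: "nat \<Rightarrow> real"
  assumes "1 \<le> j" "j \<le> m"
  obtains r where "1 \<le> r" "r \<le> m" "c j + c (2 * m - j + 1) = c (2 * r - 1) + c (2 * (m + 1 - r))"
proof (cases "even j")
  case True
  then obtain r where j_eq: "j = 2 * r" by blast
  show thesis
  proof
    have "2 * (m + 1 - r) - 1 = 2 * m - j + 1" "2 * (m + 1 - (m + 1 - r)) = j" using j_eq assms by auto
    then show "c j + c (2 * m - j + 1) = c (2 * (m + 1 - r) - 1) + c (2 * (m + 1 - (m + 1 - r)))"
      by simp
  qed (use j_eq assms in auto)
next
  case False
  then obtain r where j_eq: "j = 2 * r + 1" using oddE by blast
  show thesis
  proof
    have "2 * (r + 1) - 1 = j" "2 * (m + 1 - (r + 1)) = 2 * m - j + 1" using j_eq assms by auto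
    then show "c j + c (2 * m - j + 1) = c (2 * (r + 1) - 1) + c (2 * (m + 1 - (r + 1)))" by simp
  qed (use j_eq assms in auto)
qed

lemma two_flat_pair_sums:
  assumes "two_flat (2 * m) c" "1 \<le> i" "i \<le> m" "1 \<le> j" "j \<le> m"
  shows "c i + c (2 * m - i + 1) \<le> c j + c (2 * m - j + 1) + 1"
proof -
  have flat: "flat m (\<lambda>i. c (2 * i - 1))" "flat m (\<lambda>i. c (2 * i))"
    using assms(1) unfolding two_flat_def by simp_all
  obtain r where sum_i: "1 \<le> r" "r \<le> m"
    "c i + c (2 * m - i + 1) = c (2 * r - 1) + c (2 * (m + 1 - r))"
    using pair_sum_odd_even[OF assms(2,3)] .
  obtain s where sum_j: "1 \<le> s" "s \<le> m"
    "c j + c (2 * m - j + 1) = c (2 * s - 1) + c (2 * (m + 1 - s))"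
    using pair_sum_odd_even[OF assms(4,5)] .
  show ?thesis
    unfolding sum_i(3) sum_j(3) using flat_antidiagonal_sums[OF flat sum_i(1,2) sum_j(1,2)] .
qed

lemma two_flat_pair_sums_consecutive:
  assumes "two_flat (2 * m) c" "1 \<le> m"
    and Ints: "\<And>j. \<lbrakk>1 \<le> j; j \<le> m\<rbrakk> \<Longrightarrow> integral_pair (pair_at m c j)"
  obtains z :: int where
    "\<And>j. \<lbrakk>1 \<le> j; j \<le> m\<rbrakk> \<Longrightarrow> c j + c (2 * m - j + 1) \<in> {of_int z..of_int z + 1}"
proof -
  define pair_sum where "pair_sum j = c j + c (2 * m - j + 1)" for j
  obtain i where i_min: "is_arg_min pair_sum (\<lambda>j. j \<in> {1..m}) i"
    using ex_is_arg_min_if_finite[of "{1..m}" pair_sum] assms(2) by auto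
  then have i_range: "1 \<le> i" "i \<le> m" by (auto simp: is_arg_min_def)
  then have "pair_sum i \<in> \<int>"
    using Ints[of i] by (simp add: integral_pair_def pair_at_def pair_sum_def)
  then obtain z where z_eq: "pair_sum i = of_int z" by (elim Ints_cases)
  show thesis
  proof
    fix j assume j_range: "1 \<le> j" "j \<le> m"
    then have "pair_sum i \<le> pair_sum j" using i_min by (simp add: is_arg_min_linorder)
    moreover have "pair_sum j \<le> pair_sum i + 1"
      using two_flat_pair_sums[OF assms(1) j_range i_range] by (simp add: pair_sum_def)
    ultimately show "c j + c (2 * m - j + 1) \<in> {of_int z..of_int z + 1}"
      using z_eq by (simp add: pair_sum_def)
  qed
qed

lemma flat_of_constant_half:
  assumes "1 \<le> m"
    and "\<And>j. \<lbrakk>1 \<le> j; j \<le> m\<rbrakk> \<Longrightarrow> c j \<in> {v..v + 1}"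
    and "\<And>j. \<lbrakk>1 \<le> j; j \<le> m\<rbrakk> \<Longrightarrow> c (2 * m - j + 1) = v + 1"
    and "\<And>j. \<lbrakk>1 \<le> j; j < m\<rbrakk> \<Longrightarrow> c j \<le> c (Suc j)"
  shows "flat (2 * m) c"
proof -
  have upper_half: "c i = v + 1" if "m < i" "i \<le> 2 * m" for i
    using assms(3)[of "2 * m - i + 1"] that by simp
  have "c i \<le> c (i + 1)" if "1 \<le> i" "i < 2 * m" for i
  proof (cases "i < m")
    case True
    then show ?thesis using assms(4) that by simp
  next
    case False
    then show ?thesis using assms(2)[of i] upper_half[of i] upper_half[of "i + 1"] that
      by (cases "i = m") auto
  qed
  moreover have "c (2 * m) \<le> c 1 + 1" using assms(2)[of 1] upper_half[of "2 * m"] assms(1) by simp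
  ultimately show ?thesis by (simp add: flat_def)
qed

lemma flat_reverse:
  assumes "flat n (\<lambda>i. - c (n + 1 - i))" "1 \<le> n"
  shows "flat n c"
  unfolding flat_def
proof (intro conjI allI impI)
  fix i assume "1 \<le> i \<and> i < n"
  then have "1 \<le> n - i" "n - i < n" "n + 1 - (n - i) = i + 1" "n + 1 - (n - i + 1) = i" by auto
  then show "c i \<le> c (i + 1)"
    using spec[OF conjunct1[OF assms(1)[unfolded flat_def]], of "n - i"] by simp
next
  show "c n \<le> c 1 + 1" using assms by (simp add: flat_def)
qed

lemma pair_at_reverse:
  assumes "1 \<le> j" "j \<le> m"
  shows "pair_at m (\<lambda>i. - c (2 * m + 1 - i)) j = pair_flip (pair_at m c j)"
proof -
  have "2 * m + 1 - (2 * m - j + 1) = j" "2 * m + 1 - j = 2 * m - j + 1" using assms by auto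
  then show ?thesis by (simp only: pair_at_def pair_flip_def fst_conv snd_conv)
qed

lemma flat_at_end_odd:
  assumes "tracked_pairs p m k W G v"
    and "\<And>j. \<lbrakk>1 \<le> j; j \<le> m\<rbrakk> \<Longrightarrow> pair_at m c j = W (p * (2 * m - 1)) j"
  shows "flat (2 * m) c"
proof -
  interpret tracked_pairs p m k W G v by (rule assms(1))
  have c_eq: "c j = fst (W (p * (2 * m - 1)) j)" "c (2 * m - j + 1) = snd (W (p * (2 * m - 1)) j)"
    if "1 \<le> j" "j \<le> m" for j
    using assms(2)[OF that] by (simp_all add: pair_at_def prod_eq_iff)
  show ?thesis
  proof (rule flat_of_constant_half[OF m_ge])
    show "c j \<in> {v..v + 1}" "c (2 * m - j + 1) = v + 1" if "1 \<le> j" "j \<le> m" for j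
      using pair_at_end[OF that] unfolding c_eq[OF that] .
    show "c j \<le> c (Suc j)" if "1 \<le> j" "j < m" for j
      using sorted_at_end[OF that] c_eq(1)[of j] c_eq(1)[of "Suc j"] that by simp
  qed
qed

lemma flat_at_end:
  assumes W_evolution: "column_evolution p m pair_meet pair_join pair_wrap (pair_cap k) W"
    and G_evolution: "gap_evolution p m k G"
    and integral_0: "\<And>j. \<lbrakk>1 \<le> j; j \<le> m\<rbrakk> \<Longrightarrow> integral_pair (W 0 j)"
    and tracks_0: "\<And>j. \<lbrakk>1 \<le> j; j \<le> m\<rbrakk> \<Longrightarrow> tracks (of_int z + 1 / 2) (1 / 4) (W 0 j) (G 0 j)"
    and pair_at_c: "\<And>j. \<lbrakk>1 \<le> j; j \<le> m\<rbrakk> \<Longrightarrow> pair_at m c j = W (p * (2 * m - 1)) j"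
  shows "flat (2 * m) c"
proof (cases "even z")
  case False
  then obtain w where z_eq: "z = 2 * w + 1" by (elim oddE)
  have "of_int z + 1 / 2 = 2 * of_int w + (3 / 2 :: real)" by (simp add: z_eq)
  then have "tracks (2 * of_int w + 3 / 2) (1 / 4) (W 0 j) (G 0 j)" if "1 \<le> j" "j \<le> m" for j
    using tracks_0[OF that] by (simp only:)
  then have "tracked_pairs p m k W G (of_int w)"
    using W_evolution G_evolution integral_0
    by (simp add: tracked_pairs_def tracked_pairs_axioms_def)
  then show ?thesis using pair_at_c by (rule flat_at_end_odd)
next
  case True
  then obtain w where z_eq: "z = 2 * w" by (elim evenE)
  have "column_evolution p m pair_meet pair_join pair_wrap (pair_cap k) (\<lambda>n j. pair_flip (W n j))"
    using W_evolution pair_flip_hom by (rule column_evolution_image)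
  moreover have "integral_pair (pair_flip (W 0 j))" if "1 \<le> j" "j \<le> m" for j
    using integral_0[OF that] by (simp add: integral_pair_def pair_flip_def)
  moreover have "tracks (2 * of_int (- w - 1) + 3 / 2) (1 / 4) (pair_flip (W 0 j)) (G 0 j)"
    if "1 \<le> j" "j \<le> m" for j
    using tracks_0[OF that] by (simp add: z_eq tracks_def pair_flip_def abs_le_iff field_simps)
  ultimately have "tracked_pairs p m k (\<lambda>n j. pair_flip (W n j)) G (of_int (- w - 1))"
    using G_evolution by (simp add: tracked_pairs_def tracked_pairs_axioms_def)
  then have "flat (2 * m) (\<lambda>i. - c (2 * m + 1 - i))"
    by (rule flat_at_end_odd) (simp only: pair_at_reverse pair_at_c)
  moreover have "1 \<le> 2 * m" using gap_evolution.m_ge[OF G_evolution] by simp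
  ultimately show ?thesis by (rule flat_reverse)
qed

lemma flat_orbit:
  assumes p_le: "4 \<le> p" "p \<le> k" and blk_eq: "blk p k = 2 * m" and two_flat_c: "two_flat (2 * m) c"
    and range: "\<And>i. \<lbrakk>1 \<le> i; i \<le> 2 * m\<rbrakk> \<Longrightarrow> c i \<in> \<int> \<and> 0 \<le> c i \<and> c i \<le> 2 ^ (k - 1) - 1"
  shows "flat (2 * m) (orbit p k c (p * (2 * m - 1)))"
proof -
  define W where "W = (\<lambda>n. pair_at m (orbit p k c n))"
  define G where "G = gap_orbit p m k (\<lambda>j. c j - c (2 * m - j + 1))"
  have m_ge: "1 \<le> m" using blk_ge_2[OF p_le] blk_eq by simp
  have pair_range: "c j \<in> {0..2 ^ (k - 1) - 1}" "c (2 * m - j + 1) \<in> {0..2 ^ (k - 1) - 1}"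
    and integral: "integral_pair (pair_at m c j)" if "1 \<le> j" "j \<le> m" for j
    using range[of j] range[of "2 * m - j + 1"] that by (auto simp: integral_pair_def pair_at_def)
  obtain z :: int where
    pair_sums: "\<And>j. \<lbrakk>1 \<le> j; j \<le> m\<rbrakk> \<Longrightarrow> c j + c (2 * m - j + 1) \<in> {of_int z..of_int z + 1}"
    using two_flat_pair_sums_consecutive[OF two_flat_c m_ge integral] by blast
  show ?thesis
  proof (rule flat_at_end)
    show "column_evolution p m pair_meet pair_join pair_wrap (pair_cap k) W"
      unfolding W_def by (rule column_evolution_orbit[OF p_le blk_eq])
    show "gap_evolution p m k G"
      unfolding G_def
    proof (rule gap_evolution_gap_orbit[OF p_le blk_eq])
      fix j assume "1 \<le> j" "j \<le> m"
      then show "\<bar>c j - c (2 * m - j + 1)\<bar> \<le> hgt k 0"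
        using pair_range[of j] by (auto simp: hgt_def abs_le_iff)
    qed
  next
    fix j assume j_range: "1 \<le> j" "j \<le> m"
    show "integral_pair (W 0 j)" using integral[OF j_range] by (simp add: W_def)
    show "tracks (of_int z + 1 / 2) (1 / 4) (W 0 j) (G 0 j)"
      using pair_sums[OF j_range]
      by (auto simp: W_def G_def tracks_def pair_at_def abs_le_iff field_simps)
    show "pair_at m (orbit p k c (p * (2 * m - 1))) j = W (p * (2 * m - 1)) j"
      by (simp add: W_def)
  qed
qed

theorem theorem3p43:
  fixes p k b D :: nat and c :: "nat \<Rightarrow> real" and f :: "nat \<Rightarrow> (nat \<Rightarrow> real) \<Rightarrow> nat \<Rightarrow> real"
  assumes "4 \<le> p" and "p \<le> k"
    and "b = 2 * nat \<lceil>(real k - 2) / (real p - 2)\<rceil>"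
    and "D = p * (b - 1)"
    and "two_flat b c"
    and "\<And>i. i \<in> {1..b} \<Longrightarrow> c i \<in> \<int> \<and> 0 \<le> c i \<and> c i \<le> 2 ^ (k - 1) - 1"
    and "\<And>i. i \<in> {1..D} \<Longrightarrow> f i = Qmap p k ((i - 1) mod p + 1)"
  shows "flat b (fold f [1..<D + 1] c)"
proof -
  define m where "m = nat \<lceil>(real k - 2) / (real p - 2)\<rceil>"
  have b_eq: "b = 2 * m" and blk_eq: "blk p k = 2 * m"
    using assms(3) unfolding m_def blk_def by auto
  have "fold f [1..<n + 1] c = orbit p k c n" if "n \<le> D" for n
    using that by (induction n) (auto simp: assms(7))
  from this[OF order.refl] have "fold f [1..<D + 1] c = orbit p k c (p * (2 * m - 1))"
    using assms(4) b_eq by simp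
  then show ?thesis
    using flat_orbit[OF assms(1,2) blk_eq] assms(5,6) unfolding b_eq by simp
qed

end
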